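(* Let $R$ be a commutative unitary ring and $b,h,k\in R$. For all $x,y\in R$, $$I^{(x)}(\mathcal{W}(1,b,h,k))=\mathcal{W}(1,\,b+x,\,h+x,\,(h-b)x+k),$$ $$L^{(y)}(\mathcal{W}(1,b,h,k))=\mathcal{W}(1,\,b+y,\,h+2y,\,y^2+hy+k),$$ $$C^{(x,y)}(\mathcal{W}(1,b,h,k))=\mathcal{W}(1,\,b+y+x,\,h+x+2y,\,y^2+hy+k+(h-b)x+xy),$$ where $C^{(x,y)}=I^{(x)}\circ L^{(y)}=L^{(y)}\circ I^{(x)}$.
   Context: $\mathcal{W}(1,b,h,k)=\{\mathcal{W}_n\}_{n\ge0}$ is the sequence in $R$ with $\mathcal{W}_0=1$, $\mathcal{W}_1=b$, $\mathcal{W}_n=h\mathcal{W}_{n-1}-k\mathcal{W}_{n-2}$ for $n\ge2$. For a sequence $A=\{a_n\}_{n\ge0}$ in $R$ with $a_0=1$: the interpolated Invert operator $I^{(x)}$ sends $A$ to the sequence with ordinary generating function $\dfrac{\sum_{n\ge0}a_nt^n}{1-xt\sum_{n\ge0}a_nt^n}$; the interpolated Binomial operator $L^{(y)}$ sends $A$ to $\{l_n\}_{n\ge0}$ with $l_n=\sum_{j=0}^n\binom{n}{j}y^{n-j}a_j$. *)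

theory Defs
  imports "HOL-Computational_Algebra.Formal_Power_Series"
begin

text \<open>Second-order linear recurrent sequence with initial values \<open>a\<close>, \<open>b\<close> and
  characteristic polynomial \<open>t^2 - h t + k\<close>.\<close>

fun lin_rec :: "'a::comm_ring_1 \<Rightarrow> 'a \<Rightarrow> 'a \<Rightarrow> 'a \<Rightarrow> nat \<Rightarrow> 'a" where
  "lin_rec a b h k 0 = a"
| "lin_rec a b h k (Suc 0) = b"
| "lin_rec a b h k (Suc (Suc n)) = h * lin_rec a b h k (Suc n) - k * lin_rec a b h k n"

definition invert_denom :: "'a::comm_ring_1 \<Rightarrow> (nat \<Rightarrow> 'a) \<Rightarrow> 'a fps" where
  "invert_denom x A = 1 - fps_const x * fps_X * Abs_fps A"

text \<open>Division of power series in the library needs an inverse on the coefficients. The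
  denominator here has constant term 1, so over any commutative ring its reciprocal is
  \<open>fps_right_inverse _ 1\<close>, where the second argument is the inverse of the constant term.\<close>

definition invert_op :: "'a::comm_ring_1 \<Rightarrow> (nat \<Rightarrow> 'a) \<Rightarrow> nat \<Rightarrow> 'a" where
  "invert_op x A = fps_nth (Abs_fps A * fps_right_inverse (invert_denom x A) 1)"

definition binomial_op :: "'a::comm_ring_1 \<Rightarrow> (nat \<Rightarrow> 'a) \<Rightarrow> nat \<Rightarrow> 'a" where
  "binomial_op y A = (\<lambda>n. \<Sum>j=0..n. of_nat (n choose j) * y ^ (n - j) * A j)"

definition invert_binomial_op :: "'a::comm_ring_1 \<Rightarrow> 'a \<Rightarrow> (nat \<Rightarrow> 'a) \<Rightarrow> nat \<Rightarrow> 'a" where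
  "invert_binomial_op x y = invert_op x \<circ> binomial_op y"

lemma invert_denom_right_inverse:
  "invert_denom x A * fps_right_inverse (invert_denom x A) 1 = 1"
  by (rule fps_right_inverse) (simp add: invert_denom_def)

lemma invert_op_unique:
  "Abs_fps B * invert_denom x A = Abs_fps A \<longleftrightarrow> B = invert_op x A"
proof
  assume eq: "Abs_fps B * invert_denom x A = Abs_fps A"
  have "Abs_fps B = Abs_fps B * (invert_denom x A * fps_right_inverse (invert_denom x A) 1)"
    by (simp only: invert_denom_right_inverse mult_1_right)
  also have "\<dots> = Abs_fps A * fps_right_inverse (invert_denom x A) 1"
    by (simp only: eq [symmetric] mult.assoc)
  finally show "B = invert_op x A"
    by (metis invert_op_def fps_nth_Abs_fps ext)
next
  assume "B = invert_op x A"
  then have "Abs_fps B = Abs_fps A * fps_right_inverse (invert_denom x A) 1"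
    by (simp add: invert_op_def fps_eq_iff del: fps_mult_nth_0)
  then show "Abs_fps B * invert_denom x A = Abs_fps A"
    by (metis invert_denom_right_inverse mult.assoc mult.commute mult_1_right)
qed

lemma invert_op_0: "invert_op x A 0 = A 0"
  by (simp add: invert_op_def)

lemma binomial_op_0: "binomial_op y A 0 = A 0"
  by (simp add: binomial_op_def)

end

theory Submission
  imports Defs
begin

text \<open>
  Write \<open>S\<close> for the shift, \<open>A\<close> for the generating function of a sequence, \<open>X\<close> for the
  indeterminate and \<open>L\<close> for the Binomial operator with parameter \<open>y\<close>.

  Pascal's rule says \<open>S L = L (S + y)\<close>. The sequence \<open>W = lin_rec 1 b h k\<close> is annihilated by
  \<open>S^2 - h S + k\<close>, so \<open>L W\<close> is annihilated by \<open>(S - y)^2 - h (S - y) + k\<close>, and expanding this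
  gives the new coefficients.

  The Invert operator is governed by generating functions. Let \<open>N = 1 + (b - h) X\<close> and
  \<open>D = 1 - h X + k X^2\<close>, so that \<open>D W = N\<close>. The image \<open>B\<close> of \<open>W\<close> satisfies
  \<open>B = W + x X W B\<close>; multiplying by \<open>D\<close> gives \<open>(D - x X N) B = N\<close>, and \<open>D - x X N\<close> is again a
  quadratic denominator, which belongs to the claimed recurrence.

  The operators commute on all sequences because \<open>L\<close> is compatible with the twisted product
  \<open>X A B\<close>, that is, \<open>L (X A B) = X (L A) (L B)\<close>. (Formally \<open>L\<close> maps \<open>A\<close> to
  \<open>A (X / (1 - y X)) / (1 - y X)\<close>, but the identity follows from Pascal's rule alone, by
  induction on the coefficient.) So \<open>L\<close> turns the equation \<open>B = A + x X A B\<close>, which defines the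
  Invert image of \<open>A\<close>, into the equation that defines the Invert image of \<open>L A\<close>. The formula
  for the composite is then the first formula applied to the second.
\<close>

section \<open>Linear recurrences\<close>

lemma lin_rec_unique:
  assumes "F 0 = a" and "F (Suc 0) = b"
    and "\<And>n. F (Suc (Suc n)) = h * F (Suc n) - k * F n"
  shows "F = lin_rec a b h k"
proof
  fix n
  show "F n = lin_rec a b h k n"
    by (induction n rule: induct_nat_012) (simp_all add: assms)
qed

lemma lin_rec_gf:
  fixes b h k :: "'a::comm_ring_1"
  shows "Abs_fps (lin_rec 1 b h k) * (1 - fps_const h * fps_X + fps_const k * fps_X ^ 2)
    = 1 + fps_const (b - h) * fps_X" (is "?W * _ = _")
proof -
  have "?W - fps_X * (fps_const h * ?W) + fps_X * (fps_X * (fps_const k * ?W))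
      = 1 + fps_X * fps_const (b - h)"
  proof (rule fps_ext)
    fix n
    show "fps_nth (?W - fps_X * (fps_const h * ?W) + fps_X * (fps_X * (fps_const k * ?W))) n
      = fps_nth (1 + fps_X * fps_const (b - h)) n"
      by (induction n rule: induct_nat_012) simp_all
  qed
  then show ?thesis
    by (simp add: algebra_simps power2_eq_square)
qed

text \<open>The converse reads the recurrence off a rational generating function.\<close>

lemma lin_rec_from_gf:
  fixes b h k :: "'a::comm_ring_1"
  assumes "Abs_fps F * (1 - fps_const h * fps_X + fps_const k * fps_X ^ 2)
    = 1 + fps_const (b - h) * fps_X"
  shows "F = lin_rec 1 b h k"
proof (rule lin_rec_unique)
  let ?F = "Abs_fps F"
  have eq: "?F - fps_X * (fps_const h * ?F) + fps_X * (fps_X * (fps_const k * ?F))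
      = 1 + fps_X * fps_const (b - h)"
    using assms by (simp add: algebra_simps power2_eq_square)
  note coeff = arg_cong[OF eq, of "\<lambda>G. fps_nth G n" for n]
  show F0: "F 0 = 1"
    using coeff[of 0] by simp
  show "F (Suc 0) = b"
    using coeff[of 1] by (simp add: F0)
  show "F (Suc (Suc n)) = h * F (Suc n) - k * F n" for n
    using coeff[of "Suc (Suc n)"] by (simp add: algebra_simps eq_neg_iff_add_eq_0)
qed

section \<open>The Invert operator\<close>

lemma invert_op_eq:
  "Abs_fps (invert_op x A)
    = Abs_fps A + fps_const x * (fps_X * Abs_fps A * Abs_fps (invert_op x A))"
proof -
  have "Abs_fps (invert_op x A) * invert_denom x A = Abs_fps A"
    by (simp add: invert_op_unique)
  then show ?thesis
    by (simp add: invert_denom_def algebra_simps)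
qed

lemma invert_op_eqI:
  assumes "Abs_fps B = Abs_fps A + fps_const x * (fps_X * Abs_fps A * Abs_fps B)"
  shows "B = invert_op x A"
proof -
  have "Abs_fps B * invert_denom x A
      = Abs_fps B - fps_const x * (fps_X * Abs_fps A * Abs_fps B)"
    by (simp add: invert_denom_def algebra_simps)
  also have "\<dots> = Abs_fps A"
    by (subst assms) simp
  finally show ?thesis
    by (simp add: invert_op_unique)
qed

text \<open>With \<open>N = 1 + (b - h) X\<close> and \<open>D = 1 - h X + k X^2\<close>, inverting \<open>N / D\<close> gives
  \<open>N / (D - x X N)\<close>. The numerator survives, which is why \<open>b\<close> and \<open>h\<close> are shifted by the same
  amount \<open>x\<close>.\<close>

lemma invert_op_lin_rec:
  fixes b h k x :: "'a::comm_ring_1"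
  shows "invert_op x (lin_rec 1 b h k) = lin_rec 1 (b + x) (h + x) ((h - b) * x + k)"
proof (rule lin_rec_from_gf)
  let ?W = "Abs_fps (lin_rec 1 b h k)"
  let ?B = "Abs_fps (invert_op x (lin_rec 1 b h k))"
  let ?N = "1 + fps_const (b - h) * fps_X"
  let ?D = "1 - fps_const h * fps_X + fps_const k * fps_X ^ 2"
  have "?B * ?D = (?W + fps_const x * (fps_X * ?W * ?B)) * ?D"
    by (subst invert_op_eq) (rule refl)
  also have "\<dots> = ?W * ?D + fps_const x * fps_X * (?W * ?D) * ?B"
    by (simp only: distrib_right mult.assoc mult.left_commute mult.commute[of ?B ?D])
  finally have "?B * ?D = ?N + fps_const x * fps_X * ?N * ?B"
    by (simp only: lin_rec_gf)
  then have "?B * (?D - fps_const x * fps_X * ?N) = ?N"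
    by (simp add: algebra_simps)
  moreover have "?D - fps_const x * fps_X * ?N
      = 1 - fps_const (h + x) * fps_X + fps_const ((h - b) * x + k) * fps_X ^ 2"
    by (simp add: algebra_simps power2_eq_square
        flip: fps_const_add fps_const_sub fps_const_mult)
  ultimately show "?B * (1 - fps_const (h + x) * fps_X + fps_const ((h - b) * x + k) * fps_X ^ 2)
      = 1 + fps_const (b + x - (h + x)) * fps_X"
    by simp
qed

section \<open>The Binomial operator\<close>

lemma binomial_op_add: "binomial_op y (\<lambda>n. A n + B n) n = binomial_op y A n + binomial_op y B n"
  by (simp add: binomial_op_def distrib_left sum.distrib)

lemma binomial_op_scale: "binomial_op y (\<lambda>n. c * A n) n = c * binomial_op y A n"
  by (simp add: binomial_op_def sum_distrib_left mult_ac)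

text \<open>This is Pascal's rule, as a commutation rule between the Binomial operator and the shift.\<close>

lemma binomial_op_Suc:
  "binomial_op y A (Suc n) = y * binomial_op y A n + binomial_op y (\<lambda>j. A (Suc j)) n"
proof -
  have pascal: "of_nat (Suc n choose Suc j) * y ^ (n - j) * A (Suc j)
      = of_nat (n choose Suc j) * y ^ (n - j) * A (Suc j)
        + of_nat (n choose j) * y ^ (n - j) * A (Suc j)" for j
    by (simp add: algebra_simps)
  \<comment> \<open>The upper bound may be raised to \<open>n + 1\<close>, since \<open>n choose (n + 1) = 0\<close>.\<close>
  have "y * binomial_op y A n
      = (\<Sum>j=0..Suc n. of_nat (n choose j) * y ^ (Suc n - j) * A j)"
    by (simp add: binomial_op_def sum_distrib_left Suc_diff_le mult_ac binomial_eq_0)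
  also have "\<dots> = y ^ Suc n * A 0
      + (\<Sum>j=0..n. of_nat (n choose Suc j) * y ^ (n - j) * A (Suc j))"
    by (subst sum.atLeast0_atMost_Suc_shift) simp
  finally have low: "y * binomial_op y A n = \<dots>" .
  have "binomial_op y A (Suc n) = y ^ Suc n * A 0
      + (\<Sum>j=0..n. of_nat (Suc n choose Suc j) * y ^ (n - j) * A (Suc j))"
    unfolding binomial_op_def by (subst sum.atLeast0_atMost_Suc_shift) simp
  also have "\<dots> = y * binomial_op y A n + binomial_op y (\<lambda>j. A (Suc j)) n"
    unfolding low pascal sum.distrib by (simp add: binomial_op_def)
  finally show ?thesis .
qed

lemma binomial_op_lin_rec:
  fixes b h k y :: "'a::comm_ring_1"
  shows "binomial_op y (lin_rec 1 b h k) = lin_rec 1 (b + y) (h + 2 * y) (y ^ 2 + h * y + k)"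
proof (rule lin_rec_unique)
  let ?W = "lin_rec 1 b h k"
  let ?L = "binomial_op y ?W"
  show "?L 0 = 1"
    by (simp add: binomial_op_0)
  show "?L (Suc 0) = b + y"
    by (simp add: binomial_op_Suc binomial_op_0)
  fix n
  let ?L1 = "binomial_op y (\<lambda>j. ?W (Suc j)) n"
  have L1: "?L (Suc n) = y * ?L n + ?L1"
    by (rule binomial_op_Suc)
  have "binomial_op y (\<lambda>j. ?W (Suc (Suc j))) n
      = binomial_op y (\<lambda>j. h * ?W (Suc j) + (- k) * ?W j) n"
    by simp
  also have "\<dots> = h * ?L1 - k * ?L n"
    by (simp only: binomial_op_add binomial_op_scale) simp
  finally have "?L (Suc (Suc n)) = y * ?L (Suc n) + (y * ?L1 + (h * ?L1 - k * ?L n))"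
    by (simp only: binomial_op_Suc)
  then show "?L (Suc (Suc n)) = (h + 2 * y) * ?L (Suc n) - (y ^ 2 + h * y + k) * ?L n"
    by (simp add: L1 algebra_simps power2_eq_square)
qed

section \<open>Commutation of the two operators\<close>

text \<open>Split off the constant term as \<open>A = a + X A'\<close>. The coefficients of \<open>L (X A B)\<close> then obey
  the same recurrence as those of \<open>X (L A) (L B)\<close>, where \<open>(1 - y X) (L A) = a + X (L A')\<close>. The
  induction passes from \<open>A\<close> to \<open>A'\<close>, hence the generalization over \<open>A\<close>.\<close>

lemma binomial_op_fps_X_mult:
  fixes y :: "'a::comm_ring_1"
  shows "binomial_op y (fps_nth (fps_X * Abs_fps A * Abs_fps B)) n
    = fps_nth (fps_X * Abs_fps (binomial_op y A) * Abs_fps (binomial_op y B)) n"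
proof (induction n arbitrary: A)
  case 0
  show ?case
    by (simp add: binomial_op_0)
next
  case (Suc n)
  let ?L = "\<lambda>A. Abs_fps (binomial_op y A)"
  let ?A' = "\<lambda>j. A (Suc j)"
  have split: "Abs_fps A = fps_const (A 0) + fps_X * Abs_fps ?A'"
    by (rule fps_ext) (simp add: gr0_conv_Suc split: nat.split)
  have pascal: "?L A = fps_const (A 0) + fps_X * ?L ?A' + fps_X * (fps_const y * ?L A)"
  proof (rule fps_ext)
    fix m
    show "fps_nth (?L A) m
        = fps_nth (fps_const (A 0) + fps_X * ?L ?A' + fps_X * (fps_const y * ?L A)) m"
      by (cases m) (simp_all add: binomial_op_0 binomial_op_Suc)
  qed
  have "(\<lambda>j. fps_nth (fps_X * Abs_fps A * Abs_fps B) (Suc j))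
      = fps_nth (Abs_fps A * Abs_fps B)"
    by (simp add: mult.assoc)
  also have "\<dots> = (\<lambda>j. A 0 * B j + fps_nth (fps_X * Abs_fps ?A' * Abs_fps B) j)"
    by (subst split) (simp add: distrib_right fun_eq_iff)
  finally have shift: "(\<lambda>j. fps_nth (fps_X * Abs_fps A * Abs_fps B) (Suc j)) = \<dots>" .
  have "binomial_op y (fps_nth (fps_X * Abs_fps A * Abs_fps B)) (Suc n)
      = y * fps_nth (fps_X * ?L A * ?L B) n
        + (A 0 * binomial_op y B n + fps_nth (fps_X * ?L ?A' * ?L B) n)"
    unfolding binomial_op_Suc shift binomial_op_add binomial_op_scale Suc.IH ..
  also have "\<dots> = fps_nth ((fps_const (A 0) + fps_X * ?L ?A' + fps_X * (fps_const y * ?L A)) * ?L B) n"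
  proof -
    have "(fps_const (A 0) + fps_X * ?L ?A' + fps_X * (fps_const y * ?L A)) * ?L B
        = fps_const (A 0) * ?L B + fps_X * ?L ?A' * ?L B + fps_const y * (fps_X * ?L A * ?L B)"
      by (simp add: algebra_simps)
    then show ?thesis
      by (simp only: fps_add_nth fps_mult_left_const_nth fps_nth_Abs_fps add_ac)
  qed
  also have "\<dots> = fps_nth (?L A * ?L B) n"
    by (simp only: pascal[symmetric])
  also have "\<dots> = fps_nth (fps_X * ?L A * ?L B) (Suc n)"
    by (simp add: mult.assoc)
  finally show ?case .
qed

lemma binomial_op_invert_op:
  fixes x y :: "'a::comm_ring_1"
  shows "binomial_op y (invert_op x A) = invert_op x (binomial_op y A)"
proof (rule invert_op_eqI, rule fps_ext)
  fix n
  let ?B = "invert_op x A"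
  have "fps_nth (Abs_fps ?B) j
      = fps_nth (Abs_fps A + fps_const x * (fps_X * Abs_fps A * Abs_fps ?B)) j" for j
    using invert_op_eq[of x A] by (rule arg_cong)
  then have "?B = (\<lambda>j. A j + x * fps_nth (fps_X * Abs_fps A * Abs_fps ?B) j)"
    by (simp only: fps_add_nth fps_mult_left_const_nth fps_nth_Abs_fps fun_eq_iff) simp
  then have "binomial_op y ?B n
      = binomial_op y (\<lambda>j. A j + x * fps_nth (fps_X * Abs_fps A * Abs_fps ?B) j) n"
    by (rule arg_cong)
  also have "\<dots> = binomial_op y A n
      + x * fps_nth (fps_X * Abs_fps (binomial_op y A) * Abs_fps (binomial_op y ?B)) n"
    by (simp only: binomial_op_add binomial_op_scale binomial_op_fps_X_mult)
  finally show "fps_nth (Abs_fps (binomial_op y ?B)) n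
      = fps_nth (Abs_fps (binomial_op y A)
        + fps_const x * (fps_X * Abs_fps (binomial_op y A) * Abs_fps (binomial_op y ?B))) n"
    by (simp only: fps_add_nth fps_mult_left_const_nth fps_nth_Abs_fps)
qed

theorem theorem2p2:
  fixes b h k x y :: "'a::comm_ring_1"
  shows "invert_op x (lin_rec 1 b h k) = lin_rec 1 (b + x) (h + x) ((h - b) * x + k) \<and>
    binomial_op y (lin_rec 1 b h k) = lin_rec 1 (b + y) (h + 2 * y) (y ^ 2 + h * y + k) \<and>
    (\<forall>A :: nat \<Rightarrow> 'a. A 0 = 1 \<longrightarrow>
       invert_binomial_op x y A = (invert_op x \<circ> binomial_op y) A \<and>
       invert_binomial_op x y A = (binomial_op y \<circ> invert_op x) A) \<and>
    invert_binomial_op x y (lin_rec 1 b h k) =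
      lin_rec 1 (b + y + x) (h + x + 2 * y) (y ^ 2 + h * y + k + (h - b) * x + x * y)"
proof -
  have "invert_binomial_op x y (lin_rec 1 b h k)
      = lin_rec 1 (b + y + x) (h + 2 * y + x)
          ((h + 2 * y - (b + y)) * x + (y ^ 2 + h * y + k))"
    by (simp only: invert_binomial_op_def comp_apply binomial_op_lin_rec invert_op_lin_rec)
  also have "h + 2 * y + x = h + x + 2 * y"
    by (simp add: algebra_simps)
  also have "(h + 2 * y - (b + y)) * x + (y ^ 2 + h * y + k)
      = y ^ 2 + h * y + k + (h - b) * x + x * y"
    by (simp add: algebra_simps)
  finally show ?thesis
    by (simp add: invert_op_lin_rec binomial_op_lin_rec binomial_op_invert_op
        invert_binomial_op_def)
qed

end
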